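(* Let $A\in S^{n\times n}$, $B\in\mathbb{R}^{l\times n}$ with $l\in\mathbb{N}$, $a,x_0,b_1\in\mathbb{R}^n$ and $\alpha,\beta_1\in\mathbb{R}$, and consider the problem $$(GP_2)\quad\min\{x^TAx+a^Tx:\ \|x-x_0\|^2\le\alpha,\ \|Bx\|^2+b_1^Tx\le\beta_1\}.$$ Suppose that ${\rm dim}\big({\rm Ker}(A-\lambda_{\min}(A)I_n)\cap{\rm Ker}(B)\big)\ge 2$. Then $(GP_2)$ admits exact SDP relaxation, i.e., the optimal value of $(GP_2)$ equals the optimal value of its SDP relaxation $$\min_{X\in S^{n+1}_+}\ {\rm Tr}(MX)\quad\mbox{s.t.}\quad{\rm Tr}(H_0X)\le 0,\ {\rm Tr}(H_1X)\le 0,\ X_{n+1,n+1}=1,$$ where $$M=\left(\begin{array}{cc} A & a/2\\ a^T/2 & 0\end{array}\right),\ H_0=\left(\begin{array}{cc} I_n & -x_0\\ -x_0^T & \|x_0\|^2-\alpha\end{array}\right),\ H_1=\left(\begin{array}{cc} B^TB & b_1/2\\ b_1^T/2 & -\beta_1\end{array}\right).$$ Moreover, suppose further that there exists $\overline{x}\in\mathbb{R}^n$ such that $\|\overline{x}-x_0\|^2<\alpha$ and $\|B\overline{x}\|^2+b_1^T\overline{x}<\beta_1$. Then strong duality holds for $(GP_2)$, i.e., $$\min_{x\in\mathbb{R}^n}\{x^TAx+a^Tx:\|x-x_0\|^2\le\alpha,\ \|Bx\|^2+b_1^Tx\le\beta_1\}$$ $$=\max_{\lambda_0,\lambda_1\ge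 0}\ \min_{x\in\mathbb{R}^n}\{x^TAx+a^Tx+\lambda_0(\|x-x_0\|^2-\alpha)+\lambda_1(\|Bx\|^2+b_1^Tx-\beta_1)\}.$$
   Context: $S^{n\times n}$ is the space of real symmetric $n\times n$ matrices, $S^{n+1}_+$ the set of positive semidefinite symmetric $(n+1)\times(n+1)$ matrices, $\lambda_{\min}(A)$ the smallest eigenvalue of $A$, ${\rm Ker}(M)=\{d: Md=0\}$, and $\|\cdot\|$ the Euclidean norm. The optimal value of an infeasible minimization problem is $+\infty$. The inner (unconstrained) minimum over $x$ in the dual is understood as an infimum, possibly $-\infty$. *)

theory Defs
  imports "HOL-Analysis.Analysis"
begin

definition eigenvalues :: "real^'n^'n \<Rightarrow> real set" where
  "eigenvalues A = {k. \<exists>v. v \<noteq> 0 \<and> A *v v = k *\<^sub>R v}"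

text \<open>Only used for symmetric matrices, where the set of real eigenvalues is finite and nonempty.\<close>
definition lambda_min :: "real^'n^'n \<Rightarrow> real" where
  "lambda_min A = Min (eigenvalues A)"

definition Ker :: "real^'n^'m \<Rightarrow> (real^'n) set" where
  "Ker M = {d. M *v d = 0}"

definition symmetric_matrix :: "real^'n^'n \<Rightarrow> bool" where
  "symmetric_matrix A \<longleftrightarrow> transpose A = A"

definition psd :: "real^'n^'n \<Rightarrow> bool" where
  "psd X \<longleftrightarrow> symmetric_matrix X \<and> (\<forall>v. 0 \<le> v \<bullet> (X *v v))"

text \<open>The index type \<open>'n + 1\<close> has \<open>CARD('n) + 1\<close> elements; \<open>Inr 1\<close> is the last index
  \<open>n + 1\<close>. The matrix below has blocks \<open>P, q\<close> in the first row and \<open>q\<^sup>T, r\<close> in the second.\<close>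
definition bordered :: "real^'n^'n \<Rightarrow> real^'n \<Rightarrow> real \<Rightarrow> real^('n + 1)^('n + 1)" where
  "bordered P q r = (\<chi> i j. case (i, j) of
      (Inl i', Inl j') \<Rightarrow> P $ i' $ j'
    | (Inl i', Inr _) \<Rightarrow> q $ i'
    | (Inr _, Inl j') \<Rightarrow> q $ j'
    | (Inr _, Inr _) \<Rightarrow> r)"

definition objective :: "real^'n^'n \<Rightarrow> real^'n \<Rightarrow> real^'n \<Rightarrow> real" where
  "objective A a x = x \<bullet> (A *v x) + a \<bullet> x"

definition feasible ::
    "real^'n \<Rightarrow> real \<Rightarrow> real^'n^'l \<Rightarrow> real^'n \<Rightarrow> real \<Rightarrow> (real^'n) set" where
  "feasible x0 \<alpha> B b1 \<beta>1 =
     {x. (norm (x - x0))\<^sup>2 \<le> \<alpha> \<and> (norm (B *v x))\<^sup>2 + b1 \<bullet> x \<le> \<beta>1}"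

text \<open>Optimal values are extended reals, so that the infimum over the empty set is \<open>\<infinity>\<close>.\<close>
definition gp2_value ::
    "real^'n^'n \<Rightarrow> real^'n \<Rightarrow> real^'n \<Rightarrow> real \<Rightarrow> real^'n^'l \<Rightarrow> real^'n \<Rightarrow> real \<Rightarrow> ereal" where
  "gp2_value A a x0 \<alpha> B b1 \<beta>1 =
     (INF x \<in> feasible x0 \<alpha> B b1 \<beta>1. ereal (objective A a x))"

definition sdp_feasible ::
    "real^('n::finite + 1)^('n + 1) \<Rightarrow> real^('n + 1)^('n + 1) \<Rightarrow> (real^('n + 1)^('n + 1)) set" where
  "sdp_feasible H0 H1 =
     {X. psd X \<and> trace (H0 ** X) \<le> 0 \<and> trace (H1 ** X) \<le> 0 \<and> X $ Inr 1 $ Inr 1 = 1}"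

definition sdp_value ::
    "real^('n::finite + 1)^('n + 1) \<Rightarrow> real^('n + 1)^('n + 1) \<Rightarrow> real^('n + 1)^('n + 1) \<Rightarrow> ereal" where
  "sdp_value M H0 H1 = (INF X \<in> sdp_feasible H0 H1. ereal (trace (M ** X)))"

definition lagrangian ::
    "real^'n^'n \<Rightarrow> real^'n \<Rightarrow> real^'n \<Rightarrow> real \<Rightarrow> real^'n^'l \<Rightarrow> real^'n \<Rightarrow> real
     \<Rightarrow> real \<Rightarrow> real \<Rightarrow> real^'n \<Rightarrow> real" where
  "lagrangian A a x0 \<alpha> B b1 \<beta>1 \<mu>0 \<mu>1 x = objective A a x
     + \<mu>0 * ((norm (x - x0))\<^sup>2 - \<alpha>) + \<mu>1 * ((norm (B *v x))\<^sup>2 + b1 \<bullet> x - \<beta>1)"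

definition dual_function ::
    "real^'n^'n \<Rightarrow> real^'n \<Rightarrow> real^'n \<Rightarrow> real \<Rightarrow> real^'n^'l \<Rightarrow> real^'n \<Rightarrow> real
     \<Rightarrow> real \<Rightarrow> real \<Rightarrow> ereal" where
  "dual_function A a x0 \<alpha> B b1 \<beta>1 \<mu>0 \<mu>1 =
     (INF x. ereal (lagrangian A a x0 \<alpha> B b1 \<beta>1 \<mu>0 \<mu>1 x))"

definition dual_value ::
    "real^'n^'n \<Rightarrow> real^'n \<Rightarrow> real^'n \<Rightarrow> real \<Rightarrow> real^'n^'l \<Rightarrow> real^'n \<Rightarrow> real \<Rightarrow> ereal" where
  "dual_value A a x0 \<alpha> B b1 \<beta>1 =
     (SUP \<mu>0 \<in> {0..}. SUP \<mu>1 \<in> {0..}. dual_function A a x0 \<alpha> B b1 \<beta>1 \<mu>0 \<mu>1)"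

end

theory Submission
  imports Defs
begin

text \<open>Write a point of the relaxation as \<open>y\<close> together with a positive semidefinite \<open>Z = Y - y y\<^sup>T\<close>.
  Its objective is at least that of \<open>y\<close> plus \<open>lambda_min A * trace Z\<close>, and \<open>trace Z\<close> is slack
  in the ball constraint at \<open>y\<close>. On the common kernel the objective has curvature \<open>lambda_min A\<close>
  and the second constraint is affine; as the kernel has dimension at least two, it contains a
  direction on which two given linear forms are nonpositive, so the slack can be spent at the
  rate \<open>lambda_min A\<close>. The same exchange, applied to a convex combination of two points, shows
  that the upper image of the objective and the two constraints is convex, and strong duality
  follows by separation.\<close>

section \<open>Positive semidefinite matrices\<close>

definition rank1 :: "real^'n \<Rightarrow> real^'n^'n" where
  "rank1 u = (\<chi> i j. u $ i * u $ j)"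

lemma rank1_mult_vec: "rank1 u *v v = (u \<bullet> v) *\<^sub>R u"
  by (simp add: rank1_def matrix_vector_mult_def vec_eq_iff inner_vec_def sum_distrib_left
      sum_distrib_right mult_ac)

lemma symmetric_rank1: "symmetric_matrix (rank1 u)"
  by (simp add: symmetric_matrix_def rank1_def transpose_def vec_eq_iff mult.commute)

lemma psd_rank1: "psd (rank1 u)"
  by (simp add: psd_def symmetric_rank1 rank1_mult_vec inner_commute)

lemma trace_mult_rank1: "trace (P ** rank1 u) = u \<bullet> (P *v u)"
  for P :: "real^'n^'n"
  by (simp add: trace_def matrix_matrix_mult_def rank1_def inner_vec_def matrix_vector_mult_def
      sum_distrib_left mult_ac)

lemma trace_diff_mult: "trace ((P - Q) ** Z) = trace (P ** Z) - trace (Q ** Z)"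
  for P :: "real^'n^'n"
  by (simp add: trace_def matrix_matrix_mult_def sum_subtractf left_diff_distrib)

lemma trace_mult_diff: "trace (Z ** (P - Q)) = trace (Z ** P) - trace (Z ** Q)"
  for P :: "real^'n^'n"
  by (simp add: trace_def matrix_matrix_mult_def sum_subtractf right_diff_distrib)

lemma trace_scaleR_mult: "trace ((c *\<^sub>R P) ** Z) = c * trace (P ** Z)"
  for P :: "real^'n^'n"
  by (simp add: trace_def matrix_matrix_mult_def sum_distrib_left mult_ac)

lemma trace_mult_scaleR: "trace (Z ** (c *\<^sub>R P)) = c * trace (Z ** P)"
  for P :: "real^'n^'n"
  by (simp add: trace_def matrix_matrix_mult_def sum_distrib_left mult_ac)

lemma symmetric_matrix_nth: "symmetric_matrix X \<Longrightarrow> X $ i $ j = X $ j $ i"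
  unfolding symmetric_matrix_def transpose_def by (metis vec_lambda_beta)

lemma symmetric_matrix_inner:
  assumes "symmetric_matrix Z"
  shows "v \<bullet> (Z *v w) = w \<bullet> (Z *v v)"
  using assms unfolding symmetric_matrix_def
  by (metis dot_lmul_matrix inner_commute vector_transpose_matrix)

lemma symmetric_quadratic_form:
  assumes "symmetric_matrix Z"
  shows "(v + s *\<^sub>R w) \<bullet> (Z *v (v + s *\<^sub>R w))
    = v \<bullet> (Z *v v) + 2 * s * (v \<bullet> (Z *v w)) + s\<^sup>2 * (w \<bullet> (Z *v w))"
  using symmetric_matrix_inner[OF assms, of w v]
  by (simp add: matrix_vector_right_distrib matrix_vector_mult_scaleR inner_simps algebra_simps
      power2_eq_square)

text \<open>The form of \<open>Z\<close> at \<open>v + s *\<^sub>R w\<close> is a nonnegative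
  quadratic in \<open>s\<close>, so its discriminant is nonpositive.\<close>

lemma psd_Cauchy_Schwarz:
  assumes "psd Z"
  shows "(v \<bullet> (Z *v w))\<^sup>2 \<le> (v \<bullet> (Z *v v)) * (w \<bullet> (Z *v w))"
proof -
  define p q r where "p = v \<bullet> (Z *v v)" and "q = v \<bullet> (Z *v w)" and "r = w \<bullet> (Z *v w)"
  have form: "0 \<le> p + 2 * s * q + s\<^sup>2 * r" for s
    using assms symmetric_quadratic_form[of Z v s w] unfolding psd_def p_def q_def r_def by metis
  have "r \<ge> 0" using assms by (simp add: psd_def r_def)
  show ?thesis
  proof (cases "r = 0")
    case True
    have "q = 0"
    proof (rule ccontr)
      assume "q \<noteq> 0"
      \<comment> \<open>With \<open>r = 0\<close> the quadratic is affine in \<open>s\<close>, and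
        this \<open>s\<close> gives it the value \<open>-1\<close>.\<close>
      then show False
        using form[of "- (p + 1) / (2 * q)"] True by (simp add: field_simps)
    qed
    then show ?thesis using True by (simp add: q_def r_def)
  next
    case False
    with \<open>r \<ge> 0\<close> have "r > 0" by simp
    \<comment> \<open>The point \<open>- q / r\<close> is the minimiser of the quadratic.\<close>
    have "p + 2 * (- q / r) * q + (- q / r)\<^sup>2 * r = p - q\<^sup>2 / r"
      using \<open>r > 0\<close> by (simp add: field_simps power2_eq_square)
    with form[of "- q / r"] have "q\<^sup>2 / r \<le> p" by simp
    then have "q\<^sup>2 \<le> p * r" using \<open>r > 0\<close> by (simp add: pos_divide_le_eq)
    then show ?thesis by (simp add: p_def q_def r_def)
  qed
qed

text \<open>Cauchy-Schwarz with \<open>v = Z *v w\<close> bounds the fourth power of the norm of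
  \<open>Z *v w\<close> by zero.\<close>

lemma psd_kernel:
  assumes "psd Z" and "w \<bullet> (Z *v w) = 0"
  shows "Z *v w = 0"
  using psd_Cauchy_Schwarz[OF assms(1), of "Z *v w" w] assms(2) by simp

text \<open>At \<open>v\<close> the subtracted term has the form
  \<open>(v \<bullet> (Z *v w))\<^sup>2 / (w \<bullet> (Z *v w))\<close>, which Cauchy-Schwarz
  bounds by \<open>v \<bullet> (Z *v v)\<close>.\<close>

lemma psd_schur_step:
  assumes "psd Z" and pos: "w \<bullet> (Z *v w) > 0"
  shows "psd (Z - (1 / (w \<bullet> (Z *v w))) *\<^sub>R rank1 (Z *v w))"
    (is "psd (Z - ?c *\<^sub>R _)")
proof -
  have "symmetric_matrix (Z - ?c *\<^sub>R rank1 (Z *v w))"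
    using assms(1) symmetric_rank1[of "Z *v w"]
    by (simp add: psd_def symmetric_matrix_def transpose_def vec_eq_iff)
  moreover have "0 \<le> v \<bullet> ((Z - ?c *\<^sub>R rank1 (Z *v w)) *v v)" for v
  proof -
    have "v \<bullet> ((Z - ?c *\<^sub>R rank1 (Z *v w)) *v v)
      = v \<bullet> (Z *v v) - (v \<bullet> (Z *v w))\<^sup>2 / (w \<bullet> (Z *v w))"
      by (simp add: matrix_vector_mult_diff_rdistrib scaleR_matrix_vector_assoc[symmetric]
          rank1_mult_vec inner_diff_right power2_eq_square inner_commute)
    then show ?thesis
      using psd_Cauchy_Schwarz[OF assms(1), of v w] pos by (simp add: pos_divide_le_eq)
  qed
  ultimately show ?thesis by (simp add: psd_def)
qed

lemma inner_axis_mult: "axis i 1 \<bullet> (Z *v axis i 1) = Z $ i $ i"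
  for Z :: "real^'n^'n"
  by (simp add: matrix_vector_mult_basis inner_axis' column_def)

text \<open>Each Schur step splits off a rank-one term and clears a diagonal entry; a positive
  semidefinite matrix with zero diagonal vanishes.\<close>
lemma trace_mult_psd_nonneg:
  fixes P Z :: "real^'n^'n"
  assumes P: "\<And>v. 0 \<le> v \<bullet> (P *v v)" and "psd Z"
  shows "0 \<le> trace (P ** Z)"
  using assms(2)
proof (induction "card {i. Z $ i $ i \<noteq> 0}" arbitrary: Z rule: less_induct)
  case less
  show ?case
  proof (cases "\<exists>i. Z $ i $ i \<noteq> 0")
    case False
    then have "Z *v axis i 1 = 0" for i
      using psd_kernel[OF less.prems, of "axis i 1"] inner_axis_mult[of i Z] by simp
    then have "Z = 0"
      by (simp add: matrix_vector_mult_basis column_def vec_eq_iff)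
    then show ?thesis by (simp add: trace_def)
  next
    case True
    then obtain i where i: "Z $ i $ i \<noteq> 0" by blast
    have diag: "Z $ j $ j \<ge> 0" if "psd Z" for j and Z :: "real^'n^'n"
      using that inner_axis_mult[of j Z] unfolding psd_def by metis
    define c where "c = 1 / Z $ i $ i"
    have "c > 0" using diag[OF less.prems, of i] i by (simp add: c_def)
    define Z' where "Z' = Z - c *\<^sub>R rank1 (column i Z)"
    have col: "Z *v axis i 1 = column i Z" by (simp add: matrix_vector_mult_basis)
    have psd: "psd Z'"
      using psd_schur_step[OF less.prems, of "axis i 1", unfolded inner_axis_mult] \<open>c > 0\<close>
      unfolding Z'_def c_def col by simp
    have Z'_diag: "Z' $ j $ j = Z $ j $ j - c * (Z $ j $ i)\<^sup>2" for j
      by (simp add: Z'_def rank1_def column_def power2_eq_square)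
    \<comment> \<open>A zero on the diagonal survives the step: the new entry is at most the old
      one, and nonnegative because \<open>Z'\<close> is positive semidefinite.\<close>
    have "{j. Z' $ j $ j \<noteq> 0} \<subseteq> {j. Z $ j $ j \<noteq> 0}"
    proof safe
      fix j assume "Z' $ j $ j \<noteq> 0" and "Z $ j $ j = 0"
      moreover have "c * (Z $ j $ i)\<^sup>2 \<ge> 0" using \<open>c > 0\<close> by simp
      ultimately show False using Z'_diag[of j] diag[OF psd, of j] by simp
    qed
    moreover have "Z' $ i $ i = 0"
      using i by (simp add: Z'_diag c_def power2_eq_square)
    ultimately have "{j. Z' $ j $ j \<noteq> 0} \<subset> {j. Z $ j $ j \<noteq> 0}" using i by blast
    then have "0 \<le> trace (P ** Z')"
      using less.hyps[OF _ psd] by (simp add: psubset_card_mono)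
    moreover have "0 \<le> c * (column i Z \<bullet> (P *v column i Z))"
      using \<open>c > 0\<close> P by simp
    ultimately show ?thesis
      by (simp add: Z'_def trace_mult_diff trace_mult_scaleR trace_mult_rank1)
  qed
qed

section \<open>The smallest eigenvalue\<close>

text \<open>Eigenvectors of a symmetric matrix for distinct eigenvalues are orthogonal, hence
  independent. Finiteness gives the \<open>Min\<close> in \<open>lambda_min\<close> its
  meaning.\<close>

lemma finite_eigenvalues:
  fixes A :: "real^'n^'n"
  assumes "symmetric_matrix A"
  shows "finite (eigenvalues A)"
proof -
  have "\<exists>v. v \<noteq> 0 \<and> A *v v = k *\<^sub>R v" if "k \<in> eigenvalues A" for k
    using that by (simp add: eigenvalues_def)
  then obtain e where e: "\<And>k. k \<in> eigenvalues A \<Longrightarrow> e k \<noteq> 0 \<and> A *v e k = k *\<^sub>R e k"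
    by metis
  have orth: "e k \<bullet> e l = 0" if "k \<in> eigenvalues A" "l \<in> eigenvalues A" "k \<noteq> l" for k l
    using symmetric_matrix_inner[OF assms, of "e k" "e l"] e[OF that(1)] e[OF that(2)] that(3)
    by (simp add: inner_commute)
  have "inj_on e (eigenvalues A)"
    by (rule inj_onI) (metis e inner_eq_zero_iff orth)
  moreover have "independent (e ` eigenvalues A)"
  proof (rule pairwise_orthogonal_independent)
    show "pairwise orthogonal (e ` eigenvalues A)"
      by (auto simp: pairwise_def orthogonal_def) (metis orth)
  qed (use e in force)
  ultimately show ?thesis
    using independent_imp_finite finite_imageD by blast
qed

text \<open>The minimum \<open>m\<close> of the form over the unit sphere is itself an eigenvalue,
  so \<open>lambda_min A \<le> m\<close>; homogeneity extends the bound by \<open>m\<close> to all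
  vectors.\<close>

lemma lambda_min_le_rayleigh:
  fixes A :: "real^'n^'n"
  assumes A: "symmetric_matrix A"
  shows "lambda_min A * (v \<bullet> v) \<le> v \<bullet> (A *v v)"
proof -
  have "\<exists>w \<in> sphere 0 1. \<forall>v \<in> sphere 0 1. w \<bullet> (A *v w) \<le> v \<bullet> (A *v v)"
  proof (rule continuous_attains_inf)
    show "sphere (0::real^'n) 1 \<noteq> {}" by simp
    show "continuous_on (sphere 0 1) (\<lambda>v. v \<bullet> (A *v v))"
      by (intro continuous_intros linear_continuous_on) simp
  qed simp
  then obtain w where w: "norm w = 1"
    and min: "\<And>v. norm v = 1 \<Longrightarrow> w \<bullet> (A *v w) \<le> v \<bullet> (A *v v)"
    by auto
  define m where "m = w \<bullet> (A *v w)"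
  have le: "m * (v \<bullet> v) \<le> v \<bullet> (A *v v)" for v
  proof (cases "v = 0")
    case False
    have "m \<le> (v /\<^sub>R norm v) \<bullet> (A *v (v /\<^sub>R norm v))"
      unfolding m_def using False by (intro min) simp
    also have "\<dots> = v \<bullet> (A *v v) / (v \<bullet> v)"
      by (simp add: matrix_vector_mult_scaleR dot_square_norm power2_eq_square divide_simps)
    finally show ?thesis using False by (simp add: pos_le_divide_eq)
  qed simp
  \<comment> \<open>\<open>N\<close> is positive semidefinite and its form vanishes at the minimiser
    \<open>w\<close>, so \<open>w\<close> lies in its kernel and is an eigenvector of
    \<open>A\<close> for \<open>m\<close>.\<close>
  define N where "N = A - m *\<^sub>R mat 1"
  have N: "N *v u = A *v u - m *\<^sub>R u" for u
    by (simp add: N_def matrix_vector_mult_diff_rdistrib scaleR_matrix_vector_assoc[symmetric])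
  have "symmetric_matrix N"
    using A by (simp add: symmetric_matrix_def N_def transpose_def vec_eq_iff mat_def)
  then have "psd N" using le by (simp add: psd_def N inner_diff_right)
  moreover have "w \<bullet> (N *v w) = 0" using w by (simp add: N inner_diff_right m_def dot_square_norm)
  ultimately have "A *v w = m *\<^sub>R w" using psd_kernel[of N w] by (simp add: N)
  then have "m \<in> eigenvalues A" using w unfolding eigenvalues_def by (intro CollectI exI[of _ w]) auto
  then have "lambda_min A \<le> m"
    unfolding lambda_min_def using finite_eigenvalues[OF A] by simp
  then have "lambda_min A * (v \<bullet> v) \<le> m * (v \<bullet> v)" by (simp add: mult_right_mono)
  with le[of v] show ?thesis by simp
qed

section \<open>Bordered matrices\<close>

lemma sum_UNIV_plus_1: "(\<Sum>k\<in>UNIV. f k) = (\<Sum>i\<in>UNIV. f (Inl i)) + f (Inr (1::1))"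
  for f :: "'n::finite + 1 \<Rightarrow> real"
proof -
  have "sum f (UNIV <+> UNIV) = (\<Sum>i\<in>UNIV. f (Inl i)) + f (Inr 1)"
    by (subst sum.Plus) (simp_all add: comp_def)
  then show ?thesis by (simp only: UNIV_Plus_UNIV)
qed

lemma trace_bordered_mult:
  "trace (bordered P q r ** bordered P' q' r')
    = trace (P ** P') + 2 * (q \<bullet> q') + r * r'"
  by (simp add: trace_def matrix_matrix_mult_def bordered_def sum_UNIV_plus_1 inner_vec_def
      sum.distrib)

definition snoc :: "real^'n \<Rightarrow> real \<Rightarrow> real^('n + 1)" where
  "snoc v s = (\<chi> k. case k of Inl i \<Rightarrow> v $ i | Inr _ \<Rightarrow> s)"

lemma bordered_form:
  "snoc v s \<bullet> (bordered P q r *v snoc v s) = v \<bullet> (P *v v) + 2 * s * (q \<bullet> v) + r * s\<^sup>2"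
  by (simp add: inner_vec_def matrix_vector_mult_def bordered_def snoc_def sum_UNIV_plus_1
      sum.distrib sum_distrib_left algebra_simps power2_eq_square)

text \<open>This matrix is the lift of the point \<open>x\<close> to the relaxation, the outer
  product of \<open>(x, 1)\<close> with itself.\<close>

lemma psd_bordered_rank1: "psd (bordered (rank1 x) x 1)"
proof -
  have "bordered (rank1 x) x 1 = rank1 (snoc x 1)"
    by (auto simp: bordered_def rank1_def snoc_def vec_eq_iff split: sum.splits)
  then show ?thesis by (simp add: psd_rank1)
qed

lemma symmetric_eq_bordered:
  fixes X :: "real^('n::finite + 1)^('n + 1)"
  assumes "symmetric_matrix X"
  shows "X = bordered (\<chi> i j. X $ Inl i $ Inl j) (\<chi> i. X $ Inl i $ Inr 1) (X $ Inr 1 $ Inr 1)"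
  using symmetric_matrix_nth[OF assms]
  by (auto simp: bordered_def vec_eq_iff split: sum.splits)

text \<open>For fixed \<open>v\<close> the bordered form is smallest at the last coordinate
  \<open>- (y \<bullet> v)\<close>, where it equals the form of \<open>Y - rank1 y\<close> at
  \<open>v\<close>.\<close>

lemma psd_schur_complement:
  assumes "psd (bordered Y y 1)"
  shows "psd (Y - rank1 y)"
proof -
  have "Y $ i $ j = Y $ j $ i" for i j
    using symmetric_matrix_nth[of "bordered Y y 1" "Inl i" "Inl j"] assms
    by (simp add: psd_def bordered_def)
  then have "symmetric_matrix (Y - rank1 y)"
    by (simp add: symmetric_matrix_def transpose_def rank1_def vec_eq_iff mult.commute)
  moreover have "0 \<le> v \<bullet> ((Y - rank1 y) *v v)" for v
  proof -
    have "0 \<le> snoc v (- (y \<bullet> v)) \<bullet> (bordered Y y 1 *v snoc v (- (y \<bullet> v)))"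
      using assms by (simp add: psd_def)
    then show ?thesis
      by (simp add: bordered_form matrix_vector_mult_diff_rdistrib rank1_mult_vec
          inner_diff_right power2_eq_square inner_commute)
  qed
  ultimately show ?thesis by (simp add: psd_def)
qed

section \<open>Perturbation along the common kernel\<close>

text \<open>Two dimensions leave a nonzero vector orthogonal to \<open>p\<close>; flipping its sign
  then corrects the sign against \<open>q\<close> without disturbing \<open>p\<close>.\<close>

lemma exists_descent_direction:
  fixes V :: "'a::euclidean_space set"
  assumes V: "subspace V" and "dim V \<ge> 2"
  obtains u where "u \<in> V" "u \<noteq> 0" "p \<bullet> u \<le> 0" "q \<bullet> u \<le> 0"
proof -
  have not_line: "\<not> V \<subseteq> span {v}" for v
  proof
    assume "V \<subseteq> span {v}"
    then have "dim V \<le> card {v}" by (intro dim_le_card) auto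
    with \<open>dim V \<ge> 2\<close> show False by simp
  qed
  \<comment> \<open>The span of zero is trivial, so this choice gives a nonzero vector.\<close>
  obtain v where v: "v \<in> V" "v \<noteq> 0"
    using not_line[of 0] by auto
  obtain w where w: "w \<in> V" "w \<notin> span {v}"
    using not_line[of v] by auto
  obtain u where u: "u \<in> V" "u \<noteq> 0" "p \<bullet> u = 0"
  proof (cases "p \<bullet> v = 0")
    case True
    with v that show ?thesis by blast
  next
    case False
    \<comment> \<open>The multiple of \<open>v\<close> cancels the component of \<open>w\<close>
      along \<open>p\<close>; the result is nonzero because \<open>w\<close> is not on the line of
      \<open>v\<close>.\<close>
    define u where "u = (p \<bullet> w / (p \<bullet> v)) *\<^sub>R v - w"
    have "u \<in> V" unfolding u_def using V v w by (intro subspace_diff subspace_scale) auto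
    moreover have "u \<noteq> 0"
    proof
      assume "u = 0"
      then have "w = (p \<bullet> w / (p \<bullet> v)) *\<^sub>R v" by (simp add: u_def)
      then have "w \<in> span {v}" by (metis span_base span_scale singletonI)
      with w show False by simp
    qed
    moreover have "p \<bullet> u = 0" using False by (simp add: u_def inner_diff_right)
    ultimately show ?thesis by (rule that)
  qed
  show ?thesis
  proof (cases "q \<bullet> u \<le> 0")
    case True
    with u that show ?thesis by auto
  next
    case False
    with u V show ?thesis by (intro that[of "- u"]) (auto intro: subspace_neg)
  qed
qed

lemma objective_line:
  assumes "symmetric_matrix A"
  shows "objective A a (y + s *\<^sub>R u) = objective A a y + 2 * s * (y \<bullet> (A *v u))
    + s\<^sup>2 * (u \<bullet> (A *v u)) + s * (a \<bullet> u)"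
  using symmetric_quadratic_form[OF assms, of y s u] by (simp add: objective_def inner_add_right)

lemma norm_sq_add_scaleR: "(norm (x + s *\<^sub>R u))\<^sup>2 = (norm x)\<^sup>2 + 2 * s * (x \<bullet> u) + s\<^sup>2 * (u \<bullet> u)"
  for x u :: "'a::real_inner"
  unfolding power2_norm_eq_inner
  by (simp add: inner_simps inner_commute algebra_simps power2_eq_square)

text \<open>If \<open>lambda_min A < 0\<close>, move from \<open>y\<close> along a direction of the common kernel that increases
  neither \<open>(2 * lambda_min A) *\<^sub>R x0 + a\<close> nor \<open>b1\<close>, until the slack \<open>t\<close> is used up; otherwise
  \<open>y\<close> itself works.\<close>
lemma trade_slack:
  fixes A :: "real^'n^'n" and B :: "real^'n^'l"
  assumes A: "symmetric_matrix A"
    and dim: "dim (Ker (A - lambda_min A *\<^sub>R mat 1) \<inter> Ker B) \<ge> 2"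
    and "t \<ge> 0"
  obtains x where "objective A a x \<le> objective A a y + lambda_min A * t"
    and "(norm (x - x0))\<^sup>2 \<le> (norm (y - x0))\<^sup>2 + t"
    and "(norm (B *v x))\<^sup>2 + b1 \<bullet> x \<le> (norm (B *v y))\<^sup>2 + b1 \<bullet> y"
proof (cases "lambda_min A \<ge> 0")
  case True
  then show ?thesis using that[of y] \<open>t \<ge> 0\<close> by simp
next
  case False
  define \<Lambda> where "\<Lambda> = lambda_min A"
  define V where "V = Ker (A - \<Lambda> *\<^sub>R mat 1) \<inter> Ker B"
  have V_iff: "u \<in> V \<longleftrightarrow> A *v u = \<Lambda> *\<^sub>R u \<and> B *v u = 0" for u
    by (simp add: V_def Ker_def matrix_vector_mult_diff_rdistrib
        scaleR_matrix_vector_assoc[symmetric])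
  have "subspace V"
    by (auto simp: subspace_def V_iff matrix_vector_right_distrib matrix_vector_mult_scaleR
        algebra_simps)
  \<comment> \<open>Along \<open>u\<close> the objective has linear coefficient
    \<open>2 * \<Lambda> * (y \<bullet> u) + a \<bullet> u\<close>. Measuring \<open>y\<close> from
    \<open>x0\<close> splits this into \<open>2 * \<Lambda> * d\<close> and the form that is made
    nonpositive here.\<close>
  then obtain u where u: "u \<in> V" "u \<noteq> 0"
    and p: "((2 * \<Lambda>) *\<^sub>R x0 + a) \<bullet> u \<le> 0" and q: "b1 \<bullet> u \<le> 0"
    using exists_descent_direction dim unfolding V_def \<Lambda>_def by blast
  define n d where "n = u \<bullet> u" and "d = (y - x0) \<bullet> u"
  have "n > 0" using u by (simp add: n_def)
  \<comment> \<open>\<open>s\<close> is the nonnegative root of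
    \<open>n * s\<^sup>2 + 2 * d * s = t\<close>, so the step raises the squared distance to
    \<open>x0\<close> by exactly \<open>t\<close>.\<close>
  define r s where "r = sqrt (d\<^sup>2 + n * t)" and "s = (r - d) / n"
  have r2: "r\<^sup>2 = d\<^sup>2 + n * t" using \<open>n > 0\<close> \<open>t \<ge> 0\<close> by (simp add: r_def)
  have "\<bar>d\<bar> \<le> r" unfolding r_def using \<open>n > 0\<close> \<open>t \<ge> 0\<close> by (intro real_le_rsqrt) simp
  then have "s \<ge> 0" using \<open>n > 0\<close> by (simp add: s_def)
  have "n * (2 * s * d + s\<^sup>2 * n) = (n * s + d)\<^sup>2 - d\<^sup>2"
    by (simp add: algebra_simps power2_eq_square)
  also have "n * s + d = r" using \<open>n > 0\<close> by (simp add: s_def)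
  finally have root: "2 * s * d + s\<^sup>2 * n = t" using \<open>n > 0\<close> r2 by simp
  define x where "x = y + s *\<^sub>R u"
  show ?thesis
  proof
    have "objective A a x = objective A a y + \<Lambda> * (2 * s * d + s\<^sup>2 * n)
        + s * (((2 * \<Lambda>) *\<^sub>R x0 + a) \<bullet> u)"
      using u V_iff unfolding x_def objective_line[OF A]
      by (simp add: d_def n_def inner_simps algebra_simps)
    also have "\<dots> \<le> objective A a y + \<Lambda> * t"
      using p \<open>s \<ge> 0\<close> by (simp add: root mult_nonneg_nonpos)
    finally show "objective A a x \<le> objective A a y + lambda_min A * t" by (simp add: \<Lambda>_def)
    show "(norm (x - x0))\<^sup>2 \<le> (norm (y - x0))\<^sup>2 + t"
      using root norm_sq_add_scaleR[of "y - x0" s u]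
      by (simp add: x_def d_def n_def algebra_simps)
    show "(norm (B *v x))\<^sup>2 + b1 \<bullet> x \<le> (norm (B *v y))\<^sup>2 + b1 \<bullet> y"
      using u V_iff q \<open>s \<ge> 0\<close>
      by (simp add: x_def matrix_vector_right_distrib matrix_vector_mult_scaleR
          inner_add_right mult_nonneg_nonpos)
  qed
qed

section \<open>Exactness of the semidefinite relaxation\<close>

lemma inner_transpose_mult: "x \<bullet> ((transpose B ** B) *v x) = (norm (B *v x))\<^sup>2"
  for B :: "real^'n^'l"
  by (metis matrix_vector_mul_assoc dot_lmul_matrix vector_transpose_matrix power2_norm_eq_inner)

text \<open>Every matrix of the relaxation is matched by a feasible point that is at least as good:
  its last column \<open>y\<close>, moved by \<open>trade_slack\<close> with slack
  \<open>trace Z\<close>.\<close>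

lemma sdp_feasible_rounding:
  fixes A :: "real^'n^'n" and B :: "real^'n^'l"
  assumes A: "symmetric_matrix A"
    and dim: "dim (Ker (A - lambda_min A *\<^sub>R mat 1) \<inter> Ker B) \<ge> 2"
    and X: "X \<in> sdp_feasible (bordered (mat 1) (- x0) ((norm x0)\<^sup>2 - \<alpha>))
          (bordered (transpose B ** B) ((1/2) *\<^sub>R b1) (- \<beta>1))"
  obtains x where "x \<in> feasible x0 \<alpha> B b1 \<beta>1"
    and "objective A a x \<le> trace (bordered A ((1/2) *\<^sub>R a) 0 ** X)"
proof -
  define Y y where "Y = (\<chi> i j. X $ Inl i $ Inl j)" and "y = (\<chi> i. X $ Inl i $ Inr 1)"
  have X_eq: "X = bordered Y y 1"
    using X symmetric_eq_bordered[of X] by (simp add: sdp_feasible_def psd_def Y_def y_def)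
  define Z where "Z = Y - rank1 y"
  have Z: "psd Z"
    using X X_eq psd_schur_complement unfolding sdp_feasible_def Z_def by blast
  have split: "trace (P ** Y) = y \<bullet> (P *v y) + trace (P ** Z)" for P :: "real^'n^'n"
    by (simp add: Z_def trace_mult_diff trace_mult_rank1)
  \<comment> \<open>The second constraint can only improve when \<open>Y\<close> is replaced by
    \<open>rank1 y\<close>, since this nonnegative term is dropped.\<close>
  have BZ: "0 \<le> trace ((transpose B ** B) ** Z)"
    using Z by (intro trace_mult_psd_nonneg) (simp_all add: inner_transpose_mult)
  have "0 \<le> trace ((A - lambda_min A *\<^sub>R mat 1) ** Z)"
    using Z lambda_min_le_rayleigh[OF A]
    by (intro trace_mult_psd_nonneg) (simp_all add: matrix_vector_mult_diff_rdistrib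
        scaleR_matrix_vector_assoc[symmetric] inner_diff_right)
  then have AZ: "lambda_min A * trace Z \<le> trace (A ** Z)"
    by (simp add: trace_diff_mult trace_scaleR_mult)
  have tr: "0 \<le> trace Z"
    using trace_mult_psd_nonneg[OF _ Z, of "mat 1"] by simp
  obtain x where x: "objective A a x \<le> objective A a y + lambda_min A * trace Z"
    "(norm (x - x0))\<^sup>2 \<le> (norm (y - x0))\<^sup>2 + trace Z"
    "(norm (B *v x))\<^sup>2 + b1 \<bullet> x \<le> (norm (B *v y))\<^sup>2 + b1 \<bullet> y"
    using trade_slack[OF A dim tr] by blast
  show ?thesis
  proof
    \<comment> \<open>As \<open>Y\<close> is \<open>rank1 y + Z\<close>, the first constraint of the
      relaxation says exactly this.\<close>
    have "(norm (y - x0))\<^sup>2 + trace Z \<le> \<alpha>"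
      using X split[of "mat 1"]
      by (simp add: sdp_feasible_def X_eq trace_bordered_mult power2_norm_eq_inner inner_simps
          inner_commute)
    moreover have "(norm (B *v y))\<^sup>2 + b1 \<bullet> y \<le> \<beta>1"
      using X split[of "transpose B ** B"] BZ
      by (simp add: sdp_feasible_def X_eq trace_bordered_mult inner_transpose_mult)
    ultimately show "x \<in> feasible x0 \<alpha> B b1 \<beta>1"
      using x by (simp add: feasible_def)
    show "objective A a x \<le> trace (bordered A ((1/2) *\<^sub>R a) 0 ** X)"
      using x(1) AZ by (simp add: X_eq trace_bordered_mult split objective_def)
  qed
qed

text \<open>Rounding gives one inequality and the rank-one lift of a feasible point the other.
  Infeasibility is no separate case, because the infima are taken in \<open>ereal\<close>.\<close>

lemma gp2_value_eq_sdp_value: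
  fixes A :: "real^'n^'n" and B :: "real^'n^'l"
  assumes A: "symmetric_matrix A"
    and dim: "dim (Ker (A - lambda_min A *\<^sub>R mat 1) \<inter> Ker B) \<ge> 2"
  shows "gp2_value A a x0 \<alpha> B b1 \<beta>1 =
        sdp_value (bordered A ((1/2) *\<^sub>R a) 0)
          (bordered (mat 1) (- x0) ((norm x0)\<^sup>2 - \<alpha>))
          (bordered (transpose B ** B) ((1/2) *\<^sub>R b1) (- \<beta>1))"
    (is "_ = sdp_value ?M ?H0 ?H1")
proof (rule antisym)
  show "gp2_value A a x0 \<alpha> B b1 \<beta>1 \<le> sdp_value ?M ?H0 ?H1"
    unfolding sdp_value_def
  proof (rule INF_greatest)
    fix X assume "X \<in> sdp_feasible ?H0 ?H1"
    then obtain x where "x \<in> feasible x0 \<alpha> B b1 \<beta>1" "objective A a x \<le> trace (?M ** X)"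
      using sdp_feasible_rounding[OF A dim] by blast
    then show "gp2_value A a x0 \<alpha> B b1 \<beta>1 \<le> ereal (trace (?M ** X))"
      unfolding gp2_value_def by (intro INF_lower2) auto
  qed
  show "sdp_value ?M ?H0 ?H1 \<le> gp2_value A a x0 \<alpha> B b1 \<beta>1"
    unfolding gp2_value_def
  proof (rule INF_greatest)
    fix x assume x: "x \<in> feasible x0 \<alpha> B b1 \<beta>1"
    define X where "X = bordered (rank1 x) x 1"
    have "trace (?H0 ** X) = (norm (x - x0))\<^sup>2 - \<alpha>"
      by (simp add: X_def trace_bordered_mult trace_mult_rank1 power2_norm_eq_inner inner_simps
          inner_commute del: matrix_mul_lid)
    moreover have "trace (?H1 ** X) = (norm (B *v x))\<^sup>2 + b1 \<bullet> x - \<beta>1"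
      by (simp add: X_def trace_bordered_mult trace_mult_rank1 inner_transpose_mult)
    moreover have "X $ Inr 1 $ Inr 1 = 1" by (simp add: X_def bordered_def)
    ultimately have "X \<in> sdp_feasible ?H0 ?H1"
      using x psd_bordered_rank1[of x] by (simp add: sdp_feasible_def feasible_def X_def)
    moreover have "trace (?M ** X) = objective A a x"
      by (simp add: X_def trace_bordered_mult trace_mult_rank1 objective_def)
    ultimately show "sdp_value ?M ?H0 ?H1 \<le> ereal (objective A a x)"
      unfolding sdp_value_def by (intro INF_lower2) auto
  qed
qed

section \<open>Strong duality\<close>

text \<open>The deviation from affine behaviour is a multiple of the form at \<open>x - y\<close>,
  which the Rayleigh bound controls from below.\<close>

lemma objective_convex_combination:
  assumes "symmetric_matrix A" and "\<theta> + \<phi> = 1"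
  shows "objective A a (\<theta> *\<^sub>R x + \<phi> *\<^sub>R y)
    = \<theta> * objective A a x + \<phi> * objective A a y - \<theta> * \<phi> * ((x - y) \<bullet> (A *v (x - y)))"
proof -
  have \<theta>: "\<theta> = 1 - \<phi>" using assms(2) by simp
  show ?thesis
    using symmetric_matrix_inner[OF assms(1), of x y]
    by (simp add: objective_def \<theta> matrix_vector_right_distrib matrix_vector_mult_diff_distrib
        matrix_vector_mult_scaleR inner_simps algebra_simps power2_eq_square)
qed

lemma norm_sq_convex_combination:
  fixes x y :: "'a::real_inner"
  assumes "\<theta> + \<phi> = 1"
  shows "(norm (\<theta> *\<^sub>R x + \<phi> *\<^sub>R y))\<^sup>2
    = \<theta> * (norm x)\<^sup>2 + \<phi> * (norm y)\<^sup>2 - \<theta> * \<phi> * (norm (x - y))\<^sup>2"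
proof -
  have \<theta>: "\<theta> = 1 - \<phi>" using assms by simp
  show ?thesis
    unfolding power2_norm_eq_inner
    by (simp add: \<theta> inner_simps inner_commute algebra_simps power2_eq_square)
qed

text \<open>At a convex combination of two points the ball constraint gains slack \<open>t\<close>,
  while the objective exceeds the combined value by at most \<open>- lambda_min A * t\<close>. By
  \<open>trade_slack\<close> the former pays for the latter; the remaining constraint function is
  convex.\<close>

lemma convex_upper_image:
  fixes A :: "real^'n^'n" and B :: "real^'n^'l"
  assumes A: "symmetric_matrix A"
    and dim: "dim (Ker (A - lambda_min A *\<^sub>R mat 1) \<inter> Ker B) \<ge> 2"
  shows "convex {(p, q, r). \<exists>x. objective A a x \<le> p \<and> (norm (x - x0))\<^sup>2 - \<alpha> \<le> q
    \<and> (norm (B *v x))\<^sup>2 + b1 \<bullet> x - \<beta>1 \<le> r}"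
    (is "convex ?U")
proof (rule convexI)
  fix P P' :: "real \<times> real \<times> real" and \<theta> \<phi> :: real
  assume "P \<in> ?U" "P' \<in> ?U" and \<theta>\<phi>: "0 \<le> \<theta>" "0 \<le> \<phi>" "\<theta> + \<phi> = 1"
  then obtain p q r x p' q' r' x' where P: "P = (p, q, r)" "P' = (p', q', r')"
    and x: "objective A a x \<le> p" "(norm (x - x0))\<^sup>2 - \<alpha> \<le> q"
      "(norm (B *v x))\<^sup>2 + b1 \<bullet> x - \<beta>1 \<le> r"
    and x': "objective A a x' \<le> p'" "(norm (x' - x0))\<^sup>2 - \<alpha> \<le> q'"
      "(norm (B *v x'))\<^sup>2 + b1 \<bullet> x' - \<beta>1 \<le> r'"
    by auto
  define y where "y = \<theta> *\<^sub>R x + \<phi> *\<^sub>R x'"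
  \<comment> \<open>The gap between the combined squared distances to \<open>x0\<close> and the
    squared distance of \<open>y\<close> to \<open>x0\<close>.\<close>
  define t where "t = \<theta> * \<phi> * ((x - x') \<bullet> (x - x'))"
  have "t \<ge> 0" using \<theta>\<phi> by (simp add: t_def)
  then obtain z where z: "objective A a z \<le> objective A a y + lambda_min A * t"
    "(norm (z - x0))\<^sup>2 \<le> (norm (y - x0))\<^sup>2 + t"
    "(norm (B *v z))\<^sup>2 + b1 \<bullet> z \<le> (norm (B *v y))\<^sup>2 + b1 \<bullet> y"
    using trade_slack[OF A dim] by blast
  have mix: "\<theta> * f + \<phi> * g \<le> \<theta> * f' + \<phi> * g'" if "f \<le> f'" "g \<le> g'" for f g f' g' :: real
    using that \<theta>\<phi> by (intro add_mono mult_left_mono) auto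
  have "lambda_min A * t \<le> \<theta> * \<phi> * ((x - x') \<bullet> (A *v (x - x')))"
    using mult_left_mono[OF lambda_min_le_rayleigh[OF A, of "x - x'"], of "\<theta> * \<phi>"] \<theta>\<phi>
    by (simp add: t_def mult_ac)
  then have "objective A a z \<le> \<theta> * objective A a x + \<phi> * objective A a x'"
    using z(1) objective_convex_combination[OF A, of \<theta> \<phi> a x x'] \<theta>\<phi> by (simp add: y_def)
  also have "\<dots> \<le> \<theta> * p + \<phi> * p'" by (rule mix) (use x x' in auto)
  finally have f: "objective A a z \<le> \<theta> * p + \<phi> * p'" .
  have sum1: "\<theta> * c + \<phi> * c = c" for c
    using \<theta>\<phi> by (simp add: distrib_right[symmetric])
  have "y - x0 = \<theta> *\<^sub>R (x - x0) + \<phi> *\<^sub>R (x' - x0)"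
    using \<theta>\<phi> by (simp add: y_def algebra_simps) (simp add: scaleR_left.add[symmetric])
  then have "(norm (y - x0))\<^sup>2 + t = \<theta> * (norm (x - x0))\<^sup>2 + \<phi> * (norm (x' - x0))\<^sup>2"
    using norm_sq_convex_combination[of \<theta> \<phi> "x - x0" "x' - x0"] \<theta>\<phi>
    by (simp add: t_def power2_norm_eq_inner)
  then have "(norm (z - x0))\<^sup>2 - \<alpha> \<le> \<theta> * ((norm (x - x0))\<^sup>2 - \<alpha>) + \<phi> * ((norm (x' - x0))\<^sup>2 - \<alpha>)"
    using z(2) sum1[of \<alpha>] by (simp add: algebra_simps)
  also have "\<dots> \<le> \<theta> * q + \<phi> * q'" by (rule mix) (use x x' in auto)
  finally have g: "(norm (z - x0))\<^sup>2 - \<alpha> \<le> \<theta> * q + \<phi> * q'" .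
  have "(norm (B *v y))\<^sup>2 \<le> \<theta> * (norm (B *v x))\<^sup>2 + \<phi> * (norm (B *v x'))\<^sup>2"
    using norm_sq_convex_combination[of \<theta> \<phi> "B *v x" "B *v x'"] \<theta>\<phi>
    by (simp add: y_def matrix_vector_right_distrib matrix_vector_mult_scaleR)
  moreover have "b1 \<bullet> y = \<theta> * (b1 \<bullet> x) + \<phi> * (b1 \<bullet> x')"
    by (simp add: y_def inner_add_right)
  ultimately have "(norm (B *v z))\<^sup>2 + b1 \<bullet> z - \<beta>1
      \<le> \<theta> * ((norm (B *v x))\<^sup>2 + b1 \<bullet> x - \<beta>1) + \<phi> * ((norm (B *v x'))\<^sup>2 + b1 \<bullet> x' - \<beta>1)"
    using z(3) sum1[of \<beta>1] by (simp add: algebra_simps)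
  also have "\<dots> \<le> \<theta> * r + \<phi> * r'" by (rule mix) (use x x' in auto)
  finally have "(norm (B *v z))\<^sup>2 + b1 \<bullet> z - \<beta>1 \<le> \<theta> * r + \<phi> * r'" .
  with f g show "\<theta> *\<^sub>R P + \<phi> *\<^sub>R P' \<in> ?U" by (auto simp: P)
qed

text \<open>A hyperplane separates the upper image from the triples that beat \<open>m\<close> while
  satisfying both constraints. Its normal has nonnegative entries, and dividing by the first one,
  positive by Slater's condition, yields the multipliers.\<close>

lemma lagrange_multipliers:
  fixes f g h :: "'a \<Rightarrow> real"
  assumes convex: "convex {(p, q, r). \<exists>x. f x \<le> p \<and> g x \<le> q \<and> h x \<le> r}" (is "convex ?U")
    and slater: "g z < 0" "h z < 0"
    and lower: "\<And>x. g x \<le> 0 \<Longrightarrow> h x \<le> 0 \<Longrightarrow> m \<le> f x"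
  obtains \<mu> \<nu> where "\<mu> \<ge> 0" "\<nu> \<ge> 0" "\<And>x. m \<le> f x + \<mu> * g x + \<nu> * h x"
proof -
  \<comment> \<open>The strict bound on the first coordinate keeps \<open>W\<close> disjoint from
    the upper image; closeness to \<open>m\<close> is recovered by a limit below.\<close>
  define W :: "(real \<times> real \<times> real) set" where "W = {..<m} \<times> {..0} \<times> {..0}"
  have "convex W" by (simp add: W_def convex_Times)
  moreover have "W \<inter> ?U = {}"
  proof -
    have False if "(p, q, r) \<in> W" "f x \<le> p" "g x \<le> q" "h x \<le> r" for p q r x
      using that lower[of x] by (auto simp: W_def)
    then show ?thesis by auto
  qed
  moreover have "(m - 1, 0, 0) \<in> W" by (simp add: W_def)
  moreover have inU: "(f x, g x, h x) \<in> ?U" for x by auto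
  ultimately obtain c b where "c \<noteq> 0" and "\<forall>w \<in> W. c \<bullet> w \<le> b" and "\<forall>u \<in> ?U. b \<le> c \<bullet> u"
    using separating_hyperplane_sets[OF \<open>convex W\<close> convex] by blast
  then have cW: "\<And>w. w \<in> W \<Longrightarrow> c \<bullet> w \<le> b" and cU: "\<And>u. u \<in> ?U \<Longrightarrow> b \<le> c \<bullet> u"
    by blast+
  obtain \<tau> \<mu> \<nu> where c: "c = (\<tau>, \<mu>, \<nu>)" by (metis prod.exhaust)
  have W: "\<tau> * p + \<mu> * q + \<nu> * r \<le> b" if "p < m" "q \<le> 0" "r \<le> 0" for p q r
    using cW[of "(p, q, r)"] that by (simp add: W_def c)
  have U: "b \<le> \<tau> * f x + \<mu> * g x + \<nu> * h x" for x
    using cU[OF inU[of x]] by (simp add: c)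
  \<comment> \<open>A negative \<open>\<gamma>\<close> would let \<open>k - \<gamma> * s\<close>
    exceed \<open>b\<close> for large \<open>s\<close>. It applies to each entry of the normal
    because \<open>W\<close> is unbounded below in every coordinate.\<close>
  have nonneg: "\<gamma> \<ge> 0" if "\<And>s. s \<ge> 0 \<Longrightarrow> k - \<gamma> * s \<le> b" for \<gamma> k :: real
  proof (rule ccontr)
    assume "\<not> \<gamma> \<ge> 0"
    then have "k - \<gamma> * ((\<bar>b - k\<bar> + 1) / - \<gamma>) = k + \<bar>b - k\<bar> + 1" by simp
    with that[of "(\<bar>b - k\<bar> + 1) / - \<gamma>"] \<open>\<not> \<gamma> \<ge> 0\<close> show False
      by (simp add: divide_nonneg_neg)
  qed
  have "\<tau> * (m - 1) - \<tau> * s \<le> b" "\<tau> * (m - 1) - \<mu> * s \<le> b" "\<tau> * (m - 1) - \<nu> * s \<le> b"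
    if "s \<ge> 0" for s
    using that W[of "m - 1 - s" 0 0] W[of "m - 1" "- s" 0] W[of "m - 1" 0 "- s"]
    by (simp_all add: algebra_simps)
  then have "\<tau> \<ge> 0" "\<mu> \<ge> 0" "\<nu> \<ge> 0" by (blast intro: nonneg)+
  \<comment> \<open>With \<open>\<tau> = 0\<close> both terms at the Slater point are nonpositive
    with nonnegative sum, so \<open>\<mu>\<close> and \<open>\<nu>\<close> vanish too, against
    \<open>c \<noteq> 0\<close>.\<close>
  have "\<tau> \<noteq> 0"
  proof
    assume "\<tau> = 0"
    then have "0 \<le> \<mu> * g z + \<nu> * h z" using W[of "m - 1" 0 0] U[of z] by simp
    moreover have "\<mu> * g z \<le> 0" "\<nu> * h z \<le> 0"
      using \<open>\<mu> \<ge> 0\<close> \<open>\<nu> \<ge> 0\<close> slater by (simp_all add: mult_nonneg_nonpos)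
    ultimately have "\<mu> * g z = 0" "\<nu> * h z = 0" by linarith+
    then show False using slater \<open>c \<noteq> 0\<close> \<open>\<tau> = 0\<close> by (simp add: c zero_prod_def)
  qed
  with \<open>\<tau> \<ge> 0\<close> have "\<tau> > 0" by simp
  \<comment> \<open>The first coordinate tends to \<open>m\<close> from inside
    \<open>W\<close>.\<close>
  have "\<tau> * m \<le> b"
  proof (rule field_le_epsilon)
    fix e :: real assume "e > 0"
    then show "\<tau> * m \<le> b + e" using W[of "m - e / \<tau>" 0 0] \<open>\<tau> > 0\<close> by (simp add: algebra_simps)
  qed
  show ?thesis
  proof
    show "\<mu> / \<tau> \<ge> 0" "\<nu> / \<tau> \<ge> 0" using \<open>\<mu> \<ge> 0\<close> \<open>\<nu> \<ge> 0\<close> \<open>\<tau> > 0\<close> by simp_all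
    fix x
    have "\<tau> * m \<le> \<tau> * (f x + \<mu> / \<tau> * g x + \<nu> / \<tau> * h x)"
      using U[of x] \<open>\<tau> * m \<le> b\<close> \<open>\<tau> > 0\<close> by (simp add: algebra_simps)
    then show "m \<le> f x + \<mu> / \<tau> * g x + \<nu> / \<tau> * h x" using \<open>\<tau> > 0\<close> by simp
  qed
qed

text \<open>Weak duality: at a feasible point nonnegative multipliers only lower the
  objective.\<close>

lemma dual_value_le_gp2_value: "dual_value A a x0 \<alpha> B b1 \<beta>1 \<le> gp2_value A a x0 \<alpha> B b1 \<beta>1"
  unfolding dual_value_def gp2_value_def
proof (intro SUP_least INF_greatest)
  fix \<mu> \<nu> x assume "\<mu> \<in> {0::real..}" "\<nu> \<in> {0::real..}" and x: "x \<in> feasible x0 \<alpha> B b1 \<beta>1"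
  then have "\<mu> * ((norm (x - x0))\<^sup>2 - \<alpha>) \<le> 0" "\<nu> * ((norm (B *v x))\<^sup>2 + b1 \<bullet> x - \<beta>1) \<le> 0"
    by (auto simp: feasible_def intro!: mult_nonneg_nonpos)
  then have "lagrangian A a x0 \<alpha> B b1 \<beta>1 \<mu> \<nu> x \<le> objective A a x"
    by (simp add: lagrangian_def)
  then show "dual_function A a x0 \<alpha> B b1 \<beta>1 \<mu> \<nu> \<le> ereal (objective A a x)"
    unfolding dual_function_def by (intro INF_lower2[of x]) auto
qed

text \<open>The feasible set is closed and lies in a ball, so it is compact and the continuous
  objective has a minimiser.\<close>

lemma gp2_value_attained:
  fixes A :: "real^'n^'n" and B :: "real^'n^'l"
  assumes "feasible x0 \<alpha> B b1 \<beta>1 \<noteq> {}"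
  obtains x where "x \<in> feasible x0 \<alpha> B b1 \<beta>1"
    and "ereal (objective A a x) = gp2_value A a x0 \<alpha> B b1 \<beta>1"
proof -
  let ?F = "feasible x0 \<alpha> B b1 \<beta>1"
  have B: "continuous_on S (\<lambda>x. B *v x)" and A: "continuous_on S (\<lambda>x. A *v x)" for S
    by (intro linear_continuous_on; simp)+
  have "closed ?F"
    unfolding feasible_def by (intro closed_Collect_conj closed_Collect_le continuous_intros B)
  moreover have "?F \<subseteq> cball x0 (sqrt \<alpha>)"
    by (auto simp: feasible_def dist_norm norm_minus_commute intro: real_le_rsqrt)
  ultimately have "compact ?F"
    using bounded_subset bounded_cball compact_eq_bounded_closed by blast
  moreover have "continuous_on ?F (objective A a)"
    unfolding objective_def by (intro continuous_intros A)
  ultimately obtain x where x: "x \<in> ?F" "\<And>y. y \<in> ?F \<Longrightarrow> objective A a x \<le> objective A a y"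
    using continuous_attains_inf[OF _ assms] by metis
  then have "ereal (objective A a x) = gp2_value A a x0 \<alpha> B b1 \<beta>1"
    unfolding gp2_value_def by (intro antisym INF_greatest INF_lower) auto
  with x show ?thesis by (intro that)
qed

theorem theorem6p1:
  fixes A :: "real^'n^'n" and B :: "real^'n^'l"
    and a x0 b1 :: "real^'n" and \<alpha> \<beta>1 :: real
  assumes "symmetric_matrix A"
    and "dim (Ker (A - lambda_min A *\<^sub>R mat 1) \<inter> Ker B) \<ge> 2"
  shows "gp2_value A a x0 \<alpha> B b1 \<beta>1 =
        sdp_value (bordered A ((1/2) *\<^sub>R a) 0)
          (bordered (mat 1) (- x0) ((norm x0)\<^sup>2 - \<alpha>))
          (bordered (transpose B ** B) ((1/2) *\<^sub>R b1) (- \<beta>1))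
    \<and> ((\<exists>xbar. (norm (xbar - x0))\<^sup>2 < \<alpha> \<and> (norm (B *v xbar))\<^sup>2 + b1 \<bullet> xbar < \<beta>1) \<longrightarrow>
        gp2_value A a x0 \<alpha> B b1 \<beta>1 = dual_value A a x0 \<alpha> B b1 \<beta>1
        \<and> (\<exists>x \<in> feasible x0 \<alpha> B b1 \<beta>1.
              ereal (objective A a x) = gp2_value A a x0 \<alpha> B b1 \<beta>1)
        \<and> (\<exists>\<mu>0 \<ge> 0. \<exists>\<mu>1 \<ge> 0.
              dual_function A a x0 \<alpha> B b1 \<beta>1 \<mu>0 \<mu>1 = dual_value A a x0 \<alpha> B b1 \<beta>1))"
proof (intro conjI[OF gp2_value_eq_sdp_value[OF assms]] impI)
  let ?v = "gp2_value A a x0 \<alpha> B b1 \<beta>1" and ?d = "dual_value A a x0 \<alpha> B b1 \<beta>1"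
  assume "\<exists>xbar. (norm (xbar - x0))\<^sup>2 < \<alpha> \<and> (norm (B *v xbar))\<^sup>2 + b1 \<bullet> xbar < \<beta>1"
  then obtain z where z: "(norm (z - x0))\<^sup>2 - \<alpha> < 0" "(norm (B *v z))\<^sup>2 + b1 \<bullet> z - \<beta>1 < 0"
    by auto
  then have "z \<in> feasible x0 \<alpha> B b1 \<beta>1" by (simp add: feasible_def)
  \<comment> \<open>Attainment makes the optimal value a real number, which can serve as the bound
    \<open>m\<close> in \<open>lagrange_multipliers\<close>.\<close>
  then obtain x where x: "x \<in> feasible x0 \<alpha> B b1 \<beta>1" "ereal (objective A a x) = ?v"
    using gp2_value_attained by blast
  have lower: "objective A a x \<le> objective A a y"
    if "(norm (y - x0))\<^sup>2 - \<alpha> \<le> 0" "(norm (B *v y))\<^sup>2 + b1 \<bullet> y - \<beta>1 \<le> 0" for y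
  proof -
    have "?v \<le> ereal (objective A a y)"
      unfolding gp2_value_def using that by (intro INF_lower) (simp add: feasible_def)
    then show ?thesis by (simp flip: x(2))
  qed
  obtain \<mu> \<nu> where \<mu>\<nu>: "\<mu> \<ge> 0" "\<nu> \<ge> 0"
    and L: "\<And>y. objective A a x \<le> lagrangian A a x0 \<alpha> B b1 \<beta>1 \<mu> \<nu> y"
    using lagrange_multipliers[OF convex_upper_image[OF assms] z lower]
    unfolding lagrangian_def by blast
  \<comment> \<open>The chain from \<open>?v\<close> through the dual function at
    \<open>\<mu>\<close> and \<open>\<nu>\<close> to \<open>?d\<close> and back to \<open>?v\<close>
    forces equality throughout, so these multipliers attain the dual maximum.\<close>
  have "?v \<le> dual_function A a x0 \<alpha> B b1 \<beta>1 \<mu> \<nu>"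
    unfolding dual_function_def x(2)[symmetric] using L by (intro INF_greatest) simp
  moreover have "dual_function A a x0 \<alpha> B b1 \<beta>1 \<mu> \<nu> \<le> ?d"
    unfolding dual_value_def using \<mu>\<nu> by (intro SUP_upper2[of \<mu>] SUP_upper) auto
  moreover have "?d \<le> ?v" by (rule dual_value_le_gp2_value)
  ultimately have "?v = ?d" "dual_function A a x0 \<alpha> B b1 \<beta>1 \<mu> \<nu> = ?d" by auto
  then show "?v = ?d \<and> (\<exists>x \<in> feasible x0 \<alpha> B b1 \<beta>1. ereal (objective A a x) = ?v)
      \<and> (\<exists>\<mu>0 \<ge> 0. \<exists>\<mu>1 \<ge> 0. dual_function A a x0 \<alpha> B b1 \<beta>1 \<mu>0 \<mu>1 = ?d)"
    using x \<mu>\<nu> by blast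
qed

end
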